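(* Let $f:\mathbb{R}^n\to\,]-\infty,+\infty]$ be convex, closed, proper and smooth, let $\alpha>0$, and let $\bm{x}^\star$ and $\bm{\lambda}^\star$ be primal and dual optimal solutions of the problem of minimizing $f(\bm{x})+\alpha\Vert\bm{z}\Vert_1$ over $(\bm{x},\bm{z})$ subject to $\bm{x}=\bm{z}$. Consider variable metrics $\mathcal{M}=\mathcal{S}^*\mathcal{S}$ of element-wise form $$\mathcal{M}^{-1}(\bm{v})=\bm{m}\odot\bm{v},$$ where $\bm{m}\in\mathbb{R}^n$ is a vector with positive entries and $\odot$ is the element-wise product. Consider, under zero initialization $\bm{\zeta}^0=0$, the metric selection problem $$\underset{\mathcal{S}}{\text{minimize}}\ \ \Vert \mathcal{S}\bm{x}^\star+(\mathcal{S}^* )^{-1}\bm{\lambda}^\star-\bm{\zeta}^0\Vert^2$$ over this class. Then the optimal choice is, element-wise, $$m_i^\star=\left|\frac{x_i^\star}{\lambda_i^\star}\right|,\qquad\text{equivalently}\qquad \mathcal{M}^\star(\bm{v})_i=\left|\frac{\lambda_i^\star}{x_i^\star}\right| v_i .$$ If $x_i^\star=0$ (and $\lambda_i^\star\neq0$), the optimal choice is in the limiting sense $m_i\downarrow 0$ (the infimum of the $i$-th component of the objective is approached as $m_i\downarrow0$). If $x_i^\star=\lambda_i^\star=0$, all positive choices of $m_i$ are equivalent.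
   Context: $\mathcal{S}$ is a bijective bounded linear operator with $\langle\cdot,\mathcal{M}\,\cdot\rangle=\langle\mathcal{S}\cdot,\mathcal{S}\cdot\rangle$; for an element-wise metric with $\mathcal{M}^{-1}(\bm{v})=\bm{m}\odot\bm{v}$ one takes $\mathcal{S}^{-1}(\bm{v})=(\mathcal{S}^* )^{-1}(\bm{v})=\bm{h}\odot\bm{v}$ with $\bm{h}$ a vector of nonzero entries and $\bm{m}=\bm{h}\odot\bm{h}$. For $\bm{\zeta}^0=0$, the objective is understood up to terms independent of $\mathcal{S}$, i.e. it is $\Vert \mathcal{S}\bm{x}^\star\Vert^2+\Vert(\mathcal{S}^* )^{-1}\bm{\lambda}^\star\Vert^2$ (the cross term $2\langle\bm{x}^\star,\bm{\lambda}^\star\rangle$ does not depend on $\mathcal{S}$). "Smooth" means $f$ is differentiable. The primal-dual solution, assumed to exist, is a saddle point of the Lagrangian $f(\bm{x})+\alpha\Vert\bm{z}\Vert_1+\langle\bm{\lambda},\bm{x}-\bm{z}\rangle$ (minimized in $\bm{x},\bm{z}$, maximized in $\bm{\lambda}$). *)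

theory Defs
  imports "HOL-Analysis.Analysis"
begin

text \<open>
  Vectors in \<open>real ^ 'n\<close> carry the component-wise product of the library, so
  \<open>m * v\<close> is the element-wise product of \<open>m\<close> and \<open>v\<close>.
\<close>

definition ereal_epigraph :: "('a \<Rightarrow> ereal) \<Rightarrow> ('a \<times> real) set" where
  "ereal_epigraph f = {(x, r). f x \<le> ereal r}"

definition convex_fun :: "('a::real_vector \<Rightarrow> ereal) \<Rightarrow> bool" where
  "convex_fun f \<longleftrightarrow> convex (ereal_epigraph f)"

definition closed_fun :: "('a::topological_space \<Rightarrow> ereal) \<Rightarrow> bool" where
  "closed_fun f \<longleftrightarrow> closed (ereal_epigraph f)"

definition proper_fun :: "('a \<Rightarrow> ereal) \<Rightarrow> bool" where
  "proper_fun f \<longleftrightarrow> (\<forall>x. f x \<noteq> -\<infinity>) \<and> (\<exists>x. f x \<noteq> \<infinity>)"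

text \<open>
  Differentiability at every point where the function is finite. As \<open>real_of_ereal\<close> sends
  \<open>\<infinity>\<close> to \<open>0\<close>, finiteness near the point has to be required separately. A function that is
  differentiable on the whole space (hence finite) is the special case of full domain.
\<close>
definition smooth_fun :: "('a::real_normed_vector \<Rightarrow> ereal) \<Rightarrow> bool" where
  "smooth_fun f \<longleftrightarrow>
     (\<forall>x. \<bar>f x\<bar> \<noteq> \<infinity> \<longrightarrow>
        x \<in> interior {y. \<bar>f y\<bar> \<noteq> \<infinity>} \<and> (\<lambda>y. real_of_ereal (f y)) differentiable (at x))"

definition l1_norm :: "real ^ 'n \<Rightarrow> real" where
  "l1_norm z = (\<Sum>i\<in>UNIV. \<bar>z $ i\<bar>)"

definition lagrangian ::
  "(real ^ 'n \<Rightarrow> ereal) \<Rightarrow> real \<Rightarrow> real ^ 'n \<Rightarrow> real ^ 'n \<Rightarrow> real ^ 'n \<Rightarrow> ereal" where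
  "lagrangian f \<alpha> x z l = f x + ereal (\<alpha> * l1_norm z) + ereal (l \<bullet> (x - z))"

definition lagrangian_saddle_point ::
  "(real ^ 'n \<Rightarrow> ereal) \<Rightarrow> real \<Rightarrow> real ^ 'n \<Rightarrow> real ^ 'n \<Rightarrow> real ^ 'n \<Rightarrow> bool" where
  "lagrangian_saddle_point f \<alpha> x z l \<longleftrightarrow>
     (\<forall>l'. lagrangian f \<alpha> x z l' \<le> lagrangian f \<alpha> x z l) \<and>
     (\<forall>x' z'. lagrangian f \<alpha> x z l \<le> lagrangian f \<alpha> x' z' l)"

definition metric_of :: "(real ^ 'n \<Rightarrow> real ^ 'n) \<Rightarrow> real ^ 'n \<Rightarrow> real ^ 'n" where
  "metric_of S = adjoint S \<circ> S"

definition elementwise_metric :: "(real ^ 'n \<Rightarrow> real ^ 'n) \<Rightarrow> real ^ 'n \<Rightarrow> bool" where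
  "elementwise_metric S m \<longleftrightarrow>
     bounded_linear S \<and> bij S \<and> (\<forall>i. m $ i > 0) \<and> (\<forall>v. inv (metric_of S) v = m * v)"

definition elementwise_class :: "(real ^ 'n \<Rightarrow> real ^ 'n) set" where
  "elementwise_class = {S. \<exists>m. elementwise_metric S m}"

definition nonzero_vecs :: "(real ^ 'n) set" where
  "nonzero_vecs = {h. \<forall>i. h $ i \<noteq> 0}"

text \<open>The diagonal operator \<open>S\<close> given by \<open>inv S v = h * v\<close>; it has \<open>m = h * h\<close>.\<close>
definition diag_op :: "real ^ 'n \<Rightarrow> real ^ 'n \<Rightarrow> real ^ 'n" where
  "diag_op h = inv (\<lambda>v. h * v)"

definition residual ::
  "real ^ 'n \<Rightarrow> real ^ 'n \<Rightarrow> real ^ 'n \<Rightarrow> (real ^ 'n \<Rightarrow> real ^ 'n) \<Rightarrow> real ^ 'n" where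
  "residual x l \<zeta> S = S x + inv (adjoint S) l - \<zeta>"

definition objective ::
  "real ^ 'n \<Rightarrow> real ^ 'n \<Rightarrow> real ^ 'n \<Rightarrow> (real ^ 'n \<Rightarrow> real ^ 'n) \<Rightarrow> real" where
  "objective x l \<zeta> S = (norm (residual x l \<zeta> S))\<^sup>2"

text \<open>The \<open>i\<close>-th summand of the objective when the squared norm is expanded.\<close>
definition objective_component ::
  "real ^ 'n \<Rightarrow> real ^ 'n \<Rightarrow> real ^ 'n \<Rightarrow> (real ^ 'n \<Rightarrow> real ^ 'n) \<Rightarrow> 'n \<Rightarrow> real" where
  "objective_component x l \<zeta> S i = (residual x l \<zeta> S $ i)\<^sup>2"

text \<open>
  Passage to the limit \<open>m $ i \<down> 0\<close> with \<open>m = h * h\<close>, \<open>h\<close> ranging over all vectors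
  with nonzero entries and no restriction on the other entries of \<open>m\<close>.
\<close>
definition vanishing_entry :: "'n \<Rightarrow> (real ^ 'n) filter" where
  "vanishing_entry i =
     inf (filtercomap (\<lambda>h. (h * h) $ i) (at_right 0)) (principal nonzero_vecs)"

end

theory Submission
  imports Defs
begin

text \<open>
  Testing the saddle point against \<open>z - z\<^sub>i e\<^sub>i\<close> gives \<open>\<alpha> \<bar>x\<^sub>i\<bar> \<le> x\<^sub>i l\<^sub>i\<close>. Since \<open>S\<^sup>* S\<close> has the
  inverse \<open>v \<mapsto> m \<odot> v\<close>, the objective separates into the summands
  \<open>x\<^sub>i\<^sup>2 / m\<^sub>i + m\<^sub>i l\<^sub>i\<^sup>2 + 2 x\<^sub>i l\<^sub>i\<close>, and completing the square bounds each of them below by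
  \<open>2 (\<bar>x\<^sub>i l\<^sub>i\<bar> + x\<^sub>i l\<^sub>i)\<close>, with equality exactly for \<open>\<bar>x\<^sub>i\<bar> = m\<^sub>i \<bar>l\<^sub>i\<bar>\<close>.
\<close>

section \<open>Infima that are approached but perhaps not attained\<close>

text \<open>Identifies infimum and minimizers without assuming that a minimizer exists: the
  objective has none as soon as some \<open>x $ i = 0\<close> with \<open>l $ i \<noteq> 0\<close>.
  It is applied to the whole objective and to its single components.\<close>

lemma
  fixes g :: "'a \<Rightarrow> real"
  assumes lower: "\<And>s. s \<in> A \<Longrightarrow> c \<le> g s"
    and mem: "\<And>k::nat. u k \<in> A"
    and lim: "(\<lambda>k. g (u k)) \<longlonglongrightarrow> c"
  shows INF_eq_approached_bound: "(INF s\<in>A. g s) = c"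
    and is_arg_min_iff_approached_bound:
      "s \<in> A \<Longrightarrow> is_arg_min g (\<lambda>s. s \<in> A) s \<longleftrightarrow> g s = c"
proof -
  have "bdd_below (g ` A)"
    using lower by (rule bdd_belowI2)
  then have "(INF s\<in>A. g s) \<le> g (u k)" for k
    using mem by (rule cINF_lower)
  then have "(INF s\<in>A. g s) \<le> c"
    using lim by (auto intro: LIMSEQ_le_const)
  moreover have "c \<le> (INF s\<in>A. g s)"
    using lower mem by (intro cINF_greatest) auto
  ultimately show "(INF s\<in>A. g s) = c"
    by simp
  assume s: "s \<in> A"
  show "is_arg_min g (\<lambda>s. s \<in> A) s \<longleftrightarrow> g s = c"
  proof
    assume "is_arg_min g (\<lambda>s. s \<in> A) s"
    then have "g s \<le> g (u k)" for k
      using mem by (simp add: is_arg_min_linorder)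
    then have "g s \<le> c"
      using lim by (auto intro: LIMSEQ_le_const)
    with lower[OF s] show "g s = c"
      by simp
  next
    assume "g s = c"
    with s lower show "is_arg_min g (\<lambda>s. s \<in> A) s"
      by (simp add: is_arg_min_linorder)
  qed
qed

section \<open>Consequences of the saddle point property\<close>

text \<open>Maximality in the multiplier forces \<open>x = z\<close>; minimality in \<open>z\<close>
  then prices the removal of one entry. For positive \<open>\<alpha>\<close> this excludes
  \<open>l $ i = 0\<close> whenever \<open>x $ i \<noteq> 0\<close>, so the optimal quotients make
  sense.\<close>

lemma saddle_point_pairing:
  fixes f :: "real ^ 'n \<Rightarrow> ereal"
  assumes proper: "proper_fun f" and saddle: "lagrangian_saddle_point f \<alpha> x z l"
  shows "\<alpha> * \<bar>x $ i\<bar> \<le> x $ i * l $ i"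
proof -
  have max: "lagrangian f \<alpha> x z l' \<le> lagrangian f \<alpha> x z l" for l'
    using saddle by (simp add: lagrangian_saddle_point_def)
  have min: "lagrangian f \<alpha> x z l \<le> lagrangian f \<alpha> x' z' l" for x' z'
    using saddle by (simp add: lagrangian_saddle_point_def)
  obtain y where "f y \<noteq> \<infinity>" "f y \<noteq> -\<infinity>"
    using proper by (auto simp: proper_fun_def)
  \<comment> \<open>The Lagrangian at the saddle point is at most its finite value at
    \<open>y\<close> and \<open>0\<close>.\<close>
  then have "f x \<noteq> \<infinity>"
    using min[of y 0] by (cases "f y") (auto simp: lagrangian_def)
  moreover have "f x \<noteq> -\<infinity>"
    using proper by (simp add: proper_fun_def)
  ultimately obtain r where r: "f x = ereal r"
    by (cases "f x") auto
  \<comment> \<open>Moving the multiplier along the constraint violation would raise the Lagrangian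
    by the squared norm of \<open>x - z\<close>.\<close>
  have "(l + (x - z)) \<bullet> (x - z) \<le> l \<bullet> (x - z)"
    using max[of "l + (x - z)"] r by (simp add: lagrangian_def)
  then have "(x - z) \<bullet> (x - z) \<le> 0"
    by (simp only: inner_add_left)
  then have xz: "x = z"
    by (metis inner_eq_zero_iff inner_ge_zero order_antisym right_minus_eq)
  define w where "w = z - axis i (z $ i)"
  have "\<alpha> * l1_norm z \<le> \<alpha> * l1_norm w + l \<bullet> (z - w)"
    using min[of x w] r by (simp add: lagrangian_def xz)
  moreover have "l \<bullet> (z - w) = x $ i * l $ i"
    by (simp add: w_def inner_axis xz)
  moreover have "l1_norm w = l1_norm z - \<bar>z $ i\<bar>"
  proof -
    have "\<bar>w $ j\<bar> = \<bar>z $ j\<bar> - (if j = i then \<bar>z $ i\<bar> else 0)" for j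
      by (simp add: w_def axis_def)
    then show ?thesis
      by (simp add: l1_norm_def sum_subtractf)
  qed
  ultimately show ?thesis
    by (simp add: xz algebra_simps)
qed

text \<open>If the adjoint identifies \<open>v\<close> and \<open>w\<close>, then
  \<open>v - w\<close>, which lies in the range of \<open>S\<close>, is orthogonal to itself.
  Surjectivity follows from injectivity in finite dimension.\<close>

lemma bij_adjoint:
  fixes S :: "'a::euclidean_space \<Rightarrow> 'a"
  assumes "linear S" "bij S"
  shows "bij (adjoint S)"
proof -
  have "inj (adjoint S)"
  proof (rule injI)
    fix v w assume eq: "adjoint S v = adjoint S w"
    obtain u where u: "S u = v - w"
      using \<open>bij S\<close> by (metis bij_pointE)
    have "S u \<bullet> v = S u \<bullet> w"
      using adjoint_works[OF \<open>linear S\<close>] eq by metis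
    then have "(v - w) \<bullet> (v - w) = 0"
      by (simp add: u inner_diff_right)
    then show "v = w"
      by simp
  qed
  then show ?thesis
    using linear_inj_imp_surj[OF adjoint_linear[OF \<open>linear S\<close>]] by (simp add: bij_def)
qed

section \<open>The scalar problem for a single coordinate\<close>

text \<open>For \<open>t = h * h\<close> with \<open>h \<noteq> 0\<close> this is the square of
  \<open>a / h + h * b\<close>; \<open>a\<close>, \<open>b\<close> and \<open>t\<close> stand for
  entries of \<open>x\<close>, \<open>l\<close> and \<open>m\<close>.\<close>

definition scale_cost :: "real \<Rightarrow> real \<Rightarrow> real \<Rightarrow> real" where
  "scale_cost a b t = a\<^sup>2 / t + t * b\<^sup>2 + 2 * (a * b)"

text \<open>The infimum of \<open>scale_cost a b\<close> over positive \<open>t\<close>, from the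
  inequality of arithmetic and geometric means. It is not attained when exactly one of
  \<open>a\<close> and \<open>b\<close> vanishes.\<close>

definition min_scale_cost :: "real \<Rightarrow> real \<Rightarrow> real" where
  "min_scale_cost a b = 2 * (\<bar>a * b\<bar> + a * b)"

text \<open>The remainder left by completing the square yields the lower bound and the equality case
  together.\<close>

lemma scale_cost_eq:
  assumes "t > 0"
  shows "scale_cost a b t = min_scale_cost a b + (\<bar>a\<bar> - t * \<bar>b\<bar>)\<^sup>2 / t"
proof -
  have "(\<bar>a\<bar> - t * \<bar>b\<bar>)\<^sup>2 / t = a\<^sup>2 / t + t * b\<^sup>2 - 2 * \<bar>a * b\<bar>"
    using assms
    by (simp add: power2_diff abs_mult power_mult_distrib add_divide_distrib diff_divide_distrib)
      (simp add: power2_eq_square)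
  then show ?thesis
    by (simp add: scale_cost_def min_scale_cost_def)
qed

lemma scale_cost_ge: "t > 0 \<Longrightarrow> min_scale_cost a b \<le> scale_cost a b t"
  by (simp add: scale_cost_eq)

lemma scale_cost_eq_min_iff:
  "t > 0 \<Longrightarrow> scale_cost a b t = min_scale_cost a b \<longleftrightarrow> \<bar>a\<bar> = t * \<bar>b\<bar>"
  by (simp add: scale_cost_eq)

lemma abs_eq_scale_iff:
  fixes a b t :: real
  assumes "a \<noteq> 0 \<Longrightarrow> b \<noteq> 0" "t > 0"
  shows "\<bar>a\<bar> = t * \<bar>b\<bar> \<longleftrightarrow> (a = 0 \<longrightarrow> b = 0) \<and> (a \<noteq> 0 \<longrightarrow> t = \<bar>a / b\<bar>)"
  using assms by (cases "a = 0") (auto simp: field_simps)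

text \<open>For \<open>a \<noteq> 0\<close> the cost is continuous at the positive optimal ratio.
  For \<open>a = 0\<close> it reduces to \<open>t * b\<^sup>2\<close>, which is constant if also
  \<open>b = 0\<close>. The filter is arbitrary so that sequences and \<open>vanishing_entry\<close>
  are both covered.\<close>

lemma tendsto_scale_cost:
  assumes "a \<noteq> 0 \<Longrightarrow> b \<noteq> 0"
    and "a \<noteq> 0 \<Longrightarrow> (t \<longlongrightarrow> \<bar>a / b\<bar>) F"
    and "a = 0 \<Longrightarrow> b \<noteq> 0 \<Longrightarrow> (t \<longlongrightarrow> 0) F"
  shows "((\<lambda>k. scale_cost a b (t k)) \<longlongrightarrow> min_scale_cost a b) F"
proof (cases "a = 0")
  case True
  then show ?thesis
    using assms(3) by (cases "b = 0")
      (auto simp: scale_cost_def min_scale_cost_def intro: tendsto_mult_left_zero)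
next
  case False
  then have b: "b \<noteq> 0" and lim: "(t \<longlongrightarrow> \<bar>a / b\<bar>) F" and pos: "\<bar>a / b\<bar> > 0"
    using assms by auto
  have "((\<lambda>k. scale_cost a b (t k)) \<longlongrightarrow> scale_cost a b \<bar>a / b\<bar>) F"
    unfolding scale_cost_def using pos by (intro tendsto_intros lim) linarith
  moreover have "scale_cost a b \<bar>a / b\<bar> = min_scale_cost a b"
    unfolding scale_cost_eq_min_iff[OF pos] using b by simp
  ultimately show ?thesis
    by simp
qed

section \<open>Operators that induce an element-wise metric\<close>

context
  fixes S :: "real ^ 'n \<Rightarrow> real ^ 'n" and m :: "real ^ 'n"
  assumes em: "elementwise_metric S m"
begin

private lemma lin: "linear S" and bij: "bij S" and inv_metric: "inv (metric_of S) v = m * v"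
  using em by (auto simp: elementwise_metric_def bounded_linear.linear)

text \<open>As \<open>inv\<close> is defined by choice, bijectivity is what makes
  \<open>inv (metric_of S)\<close> a genuine two-sided inverse.\<close>

private lemma bij_metric: "bij (metric_of S)"
  unfolding metric_of_def using bij bij_adjoint[OF lin bij] by (rule bij_comp)

lemma elementwise_metric_pos: "m $ i > 0"
  using em by (simp add: elementwise_metric_def)

lemma metric_of_elementwise: "metric_of S v $ i = v $ i / m $ i"
proof -
  have "m * metric_of S v = v"
    using inv_metric[of "metric_of S v"] bij_metric by (simp add: bij_is_inj)
  then have "m $ i * metric_of S v $ i = v $ i"
    by (metis vector_mult_component)
  then show ?thesis
    using elementwise_metric_pos[of i] by (simp add: field_simps)
qed

lemma inner_image_elementwise: "S u \<bullet> S v = u \<bullet> metric_of S v"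
  by (simp add: metric_of_def adjoint_works[OF lin])

lemma inv_adjoint_elementwise: "inv (adjoint S) v = S (m * v)"
proof -
  have "adjoint S (S (m * v)) = v"
    using bij_metric unfolding inv_metric[symmetric]
    by (metis bij_inv_eq_iff comp_apply metric_of_def)
  then show ?thesis
    using bij_adjoint[OF lin bij] by (metis bij_inv_eq_iff)
qed

text \<open>Only inner products of images enter, and these depend on the metric alone. Hence
  \<open>S\<close> may be non-diagonal, for instance a diagonal operator followed by an orthogonal
  one.\<close>

lemma norm_image_elementwise: "(norm (S v))\<^sup>2 = (\<Sum>i\<in>UNIV. (v $ i)\<^sup>2 / m $ i)"
  unfolding power2_norm_eq_inner inner_image_elementwise
  by (simp add: metric_of_elementwise inner_vec_def power2_eq_square)

lemma norm_inv_adjoint_elementwise: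
  "(norm (inv (adjoint S) v))\<^sup>2 = (\<Sum>i\<in>UNIV. m $ i * (v $ i)\<^sup>2)"
proof -
  have "(m $ i * v $ i)\<^sup>2 / m $ i = m $ i * (v $ i)\<^sup>2" for i
    using elementwise_metric_pos[of i] by (simp add: power2_eq_square)
  then show ?thesis
    by (simp add: inv_adjoint_elementwise norm_image_elementwise)
qed

text \<open>The cross term is independent of \<open>S\<close>: with
  \<open>inv (adjoint S) l = S (m * l)\<close> it becomes the pairing of \<open>x\<close> with the
  metric applied to \<open>m * l\<close>, which is \<open>l\<close>.\<close>

lemma objective_elementwise_split:
  "objective x l 0 S = (norm (S x))\<^sup>2 + (norm (inv (adjoint S) l))\<^sup>2 + 2 * (x \<bullet> l)"
proof -
  have "metric_of S (m * l) = l"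
    using bij_metric inv_metric by (metis bij_inv_eq_iff)
  then have "S x \<bullet> inv (adjoint S) l = x \<bullet> l"
    by (simp add: inv_adjoint_elementwise inner_image_elementwise)
  then show ?thesis
    by (simp add: objective_def residual_def power2_norm_eq_inner inner_add_left inner_add_right
        inner_commute)
qed

lemma objective_elementwise:
  "objective x l 0 S = (\<Sum>i\<in>UNIV. scale_cost (x $ i) (l $ i) (m $ i))"
  by (simp add: objective_elementwise_split norm_image_elementwise norm_inv_adjoint_elementwise
      inner_vec_def scale_cost_def sum.distrib sum_distrib_left)

lemma objective_elementwise_ge:
  "(\<Sum>i\<in>UNIV. min_scale_cost (x $ i) (l $ i)) \<le> objective x l 0 S"
  unfolding objective_elementwise
  by (intro sum_mono scale_cost_ge elementwise_metric_pos)

text \<open>The excess over the bound is a sum of nonnegative coordinate excesses, so it vanishes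
  only if each of them does.\<close>

lemma objective_elementwise_eq_min_iff:
  "objective x l 0 S = (\<Sum>i\<in>UNIV. min_scale_cost (x $ i) (l $ i)) \<longleftrightarrow>
    (\<forall>i. \<bar>x $ i\<bar> = m $ i * \<bar>l $ i\<bar>)"
proof -
  have "objective x l 0 S = (\<Sum>i\<in>UNIV. min_scale_cost (x $ i) (l $ i)) \<longleftrightarrow>
    (\<Sum>i\<in>UNIV. scale_cost (x $ i) (l $ i) (m $ i) - min_scale_cost (x $ i) (l $ i)) = 0"
    by (simp add: objective_elementwise sum_subtractf)
  also have "\<dots> \<longleftrightarrow> (\<forall>i. scale_cost (x $ i) (l $ i) (m $ i) = min_scale_cost (x $ i) (l $ i))"
    using scale_cost_ge elementwise_metric_pos by (subst sum_nonneg_eq_0_iff) auto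
  finally show ?thesis
    by (simp add: scale_cost_eq_min_iff elementwise_metric_pos)
qed

end

section \<open>Diagonal operators\<close>

context
  fixes h :: "real ^ 'n"
  assumes h: "h \<in> nonzero_vecs"
begin

lemma diag_op_apply: "diag_op h v = (\<chi> i. v $ i / h $ i)"
  unfolding diag_op_def using h
  by (intro inv_f_eq injI) (auto simp: nonzero_vecs_def vec_eq_iff)

lemma bij_diag_op: "bij (diag_op h)"
  using h by (intro bij_betw_byWitness[where f' = "\<lambda>v. h * v"])
    (auto simp: nonzero_vecs_def vec_eq_iff diag_op_apply)

lemma adjoint_diag_op: "adjoint (diag_op h) = diag_op h"
  by (rule adjoint_unique) (simp add: diag_op_apply inner_vec_def)

lemma inv_diag_op: "inv (diag_op h) v = h * v"
  using bij_diag_op h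
  by (intro inv_f_eq bij_is_inj) (auto simp: nonzero_vecs_def vec_eq_iff diag_op_apply)

lemma elementwise_metric_diag_op: "elementwise_metric (diag_op h) (h * h)"
proof -
  have "linear (diag_op h)"
    by (intro linearI) (auto simp: diag_op_apply vec_eq_iff add_divide_distrib)
  moreover have "inv (metric_of (diag_op h)) v = h * h * v" for v
    by (simp add: metric_of_def adjoint_diag_op o_inv_distrib bij_diag_op inv_diag_op mult.assoc)
  moreover have "(h * h) $ i > 0" for i
    using h by (auto simp: nonzero_vecs_def zero_less_mult_iff linorder_neq_iff)
  ultimately show ?thesis
    by (simp add: elementwise_metric_def linear_conv_bounded_linear bij_diag_op)
qed

text \<open>A diagonal operator is self-adjoint, so the residual has entries
  \<open>x $ i / h $ i + h $ i * l $ i\<close>. The sign of \<open>h $ i\<close> disappears on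
  squaring.\<close>

lemma objective_component_diag_op:
  "objective_component x l 0 (diag_op h) i = scale_cost (x $ i) (l $ i) ((h * h) $ i)"
proof -
  have "h $ i \<noteq> 0"
    using h by (simp add: nonzero_vecs_def)
  then show ?thesis
    by (simp add: objective_component_def residual_def adjoint_diag_op inv_diag_op diag_op_apply
        scale_cost_def power2_eq_square field_simps)
qed

end

section \<open>Minimizing sequences and the main result\<close>

lemma nonzero_vecs_sqrt:
  fixes m :: "real ^ 'n"
  assumes "\<And>i. m $ i > 0"
  shows "\<exists>h\<in>nonzero_vecs. m = h * h"
proof
  show "m = (\<chi> i. sqrt (m $ i)) * (\<chi> i. sqrt (m $ i))"
    using assms by (simp add: vec_eq_iff less_imp_le)
  show "(\<chi> i. sqrt (m $ i)) \<in> nonzero_vecs"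
    using assms by (simp add: nonzero_vecs_def) (metis less_irrefl)
qed

lemma filterlim_vanishing_entry:
  "filterlim (\<lambda>h. (h * h) $ i) (at_right 0) (vanishing_entry i)"
  unfolding vanishing_entry_def by (rule filterlim_mono[OF filterlim_filtercomap order_refl inf_le1])

text \<open>A single sequence drives all coordinates to their infima at once, so the sum of the
  infima is the infimum of the sum.\<close>

lemma minimizing_sequence_exists:
  fixes x l :: "real ^ 'n"
  assumes nz: "\<And>i. x $ i \<noteq> 0 \<Longrightarrow> l $ i \<noteq> 0"
  obtains u :: "nat \<Rightarrow> real ^ 'n" where "\<And>k. u k \<in> nonzero_vecs"
    "\<And>i. (\<lambda>k. scale_cost (x $ i) (l $ i) ((u k * u k) $ i)) \<longlonglongrightarrow> min_scale_cost (x $ i) (l $ i)"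
proof -
  \<comment> \<open>Where \<open>x $ i = 0\<close> the optimal ratio would be the inadmissible entry
    \<open>0\<close>; a positive null sequence replaces it, harmlessly so if
    \<open>l $ i = 0\<close> too.\<close>
  define m :: "nat \<Rightarrow> real ^ 'n" where
    "m k = (\<chi> i. if x $ i = 0 then inverse (real (Suc k)) else \<bar>x $ i / l $ i\<bar>)" for k
  have "\<exists>h\<in>nonzero_vecs. m k = h * h" for k
    using nz by (intro nonzero_vecs_sqrt) (auto simp: m_def)
  then obtain u where u: "\<And>k. u k \<in> nonzero_vecs" "\<And>k. m k = u k * u k"
    by metis
  have "(\<lambda>k. scale_cost (x $ i) (l $ i) (m k $ i)) \<longlonglongrightarrow> min_scale_cost (x $ i) (l $ i)" for i
    by (rule tendsto_scale_cost[OF nz])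
      (auto simp: m_def intro: LIMSEQ_inverse_real_of_nat[simplified])
  then show thesis
    unfolding u(2) by (rule that[OF u(1)])
qed

theorem proposition8p1:
  fixes f :: "real ^ 'n \<Rightarrow> ereal" and \<alpha> :: real and x z l :: "real ^ 'n"
  assumes "convex_fun f" and "closed_fun f" and "proper_fun f" and "smooth_fun f"
    and "\<alpha> > 0"
    and "lagrangian_saddle_point f \<alpha> x z l"
  shows
    \<comment> \<open>the quotients in the closed-form solution are well defined\<close>
    "(\<forall>i. x $ i \<noteq> 0 \<longrightarrow> l $ i \<noteq> 0) \<and>
    \<comment> \<open>the objective up to a term that does not depend on the operator\<close>
    (\<forall>S\<in>elementwise_class.
       objective x l 0 S = (norm (S x))\<^sup>2 + (norm (inv (adjoint S) l))\<^sup>2 + 2 * (x \<bullet> l)) \<and>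
    \<comment> \<open>every positive vector is realised by an operator with diagonal inverse\<close>
    (\<forall>m :: real ^ 'n. (\<forall>i. m $ i > 0) \<longrightarrow> (\<exists>h\<in>nonzero_vecs. m = h * h)) \<and>
    (\<forall>h :: real ^ 'n\<in>nonzero_vecs. elementwise_metric (diag_op h) (h * h) \<and>
       (\<forall>v. inv (diag_op h) v = h * v \<and> inv (adjoint (diag_op h)) v = h * v)) \<and>
    \<comment> \<open>the minimizers of the metric selection problem, in terms of the inverse metric and
       of the metric\<close>
    (\<forall>S m. elementwise_metric S m \<longrightarrow>
       (is_arg_min (objective x l 0) (\<lambda>S. S \<in> elementwise_class) S \<longleftrightarrow>
         (\<forall>i. x $ i = 0 \<longrightarrow> l $ i = 0) \<and>
         (\<forall>i. x $ i \<noteq> 0 \<longrightarrow> m $ i = \<bar>x $ i / l $ i\<bar>)) \<and>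
       (is_arg_min (objective x l 0) (\<lambda>S. S \<in> elementwise_class) S \<longleftrightarrow>
         (\<forall>i. x $ i = 0 \<longrightarrow> l $ i = 0) \<and>
         (\<forall>i v. x $ i \<noteq> 0 \<longrightarrow> metric_of S v $ i = \<bar>l $ i / x $ i\<bar> * v $ i))) \<and>
    \<comment> \<open>the general case, with entries of the inverse metric that tend to zero\<close>
    (\<forall>S m. (\<forall>k. elementwise_metric (S k) (m k)) \<and>
       (\<forall>i. x $ i \<noteq> 0 \<longrightarrow> (\<lambda>k::nat. m k $ i) \<longlonglongrightarrow> \<bar>x $ i / l $ i\<bar>) \<and>
       (\<forall>i. x $ i = 0 \<and> l $ i \<noteq> 0 \<longrightarrow> (\<lambda>k. m k $ i) \<longlonglongrightarrow> 0) \<longrightarrow>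
       (\<lambda>k. objective x l 0 (S k)) \<longlonglongrightarrow> (INF S\<in>elementwise_class. objective x l 0 S)) \<and>
    \<comment> \<open>the individual components\<close>
    (\<forall>i. x $ i \<noteq> 0 \<longrightarrow>
       (\<forall>h\<in>nonzero_vecs.
         is_arg_min (\<lambda>h. objective_component x l 0 (diag_op h) i) (\<lambda>h. h \<in> nonzero_vecs) h \<longleftrightarrow>
         (h * h) $ i = \<bar>x $ i / l $ i\<bar>)) \<and>
    (\<forall>i. x $ i = 0 \<and> l $ i \<noteq> 0 \<longrightarrow>
       ((\<lambda>h. objective_component x l 0 (diag_op h) i) \<longlongrightarrow>
         (INF h\<in>nonzero_vecs. objective_component x l 0 (diag_op h) i)) (vanishing_entry i)) \<and>
    (\<forall>i. x $ i = 0 \<and> l $ i = 0 \<longrightarrow>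
       (\<forall>h\<in>nonzero_vecs. \<forall>h'\<in>nonzero_vecs.
         objective_component x l 0 (diag_op h) i = objective_component x l 0 (diag_op h') i) \<and>
       (\<forall>S S' m m'. elementwise_metric S m \<and> elementwise_metric S' m' \<and>
         (\<forall>j. j \<noteq> i \<longrightarrow> m $ j = m' $ j) \<longrightarrow>
         objective x l 0 S = objective x l 0 S'))"
proof (intro conjI)
  have pairing: "\<alpha> * \<bar>x $ i\<bar> \<le> x $ i * l $ i" for i
    using assms by (intro saddle_point_pairing)
  have nz: "l $ i \<noteq> 0" if "x $ i \<noteq> 0" for i
    using pairing[of i] that \<open>\<alpha> > 0\<close> by (auto simp: mult_le_0_iff)
  then show "\<forall>i. x $ i \<noteq> 0 \<longrightarrow> l $ i \<noteq> 0"
    by simp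
  show "\<forall>S\<in>elementwise_class.
      objective x l 0 S = (norm (S x))\<^sup>2 + (norm (inv (adjoint S) l))\<^sup>2 + 2 * (x \<bullet> l)"
    by (auto simp: elementwise_class_def objective_elementwise_split)
  show "\<forall>m :: real ^ 'n. (\<forall>i. m $ i > 0) \<longrightarrow> (\<exists>h\<in>nonzero_vecs. m = h * h)"
    using nonzero_vecs_sqrt by blast
  show "\<forall>h :: real ^ 'n\<in>nonzero_vecs. elementwise_metric (diag_op h) (h * h) \<and>
      (\<forall>v. inv (diag_op h) v = h * v \<and> inv (adjoint (diag_op h)) v = h * v)"
    by (simp add: elementwise_metric_diag_op adjoint_diag_op inv_diag_op)

  obtain u :: "nat \<Rightarrow> real ^ 'n" where u: "\<And>k. u k \<in> nonzero_vecs"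
    and cost_lim: "\<And>i. (\<lambda>k. scale_cost (x $ i) (l $ i) ((u k * u k) $ i))
      \<longlonglongrightarrow> min_scale_cost (x $ i) (l $ i)"
    using minimizing_sequence_exists[OF nz] by blast
  let ?C = "\<Sum>i\<in>UNIV. min_scale_cost (x $ i) (l $ i)"

  have lower: "?C \<le> objective x l 0 S" if "S \<in> elementwise_class" for S
    using that by (auto simp: elementwise_class_def intro: objective_elementwise_ge)
  have mem: "diag_op (u k) \<in> elementwise_class" for k
    using elementwise_metric_diag_op[OF u] by (auto simp: elementwise_class_def)
  have lim: "(\<lambda>k. objective x l 0 (diag_op (u k))) \<longlonglongrightarrow> ?C"
    unfolding objective_elementwise[OF elementwise_metric_diag_op[OF u]]
    by (intro tendsto_sum cost_lim)

  have comp_lower: "min_scale_cost (x $ i) (l $ i) \<le> objective_component x l 0 (diag_op h) i"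
    if "h \<in> nonzero_vecs" for h i
    using elementwise_metric_pos[OF elementwise_metric_diag_op[OF that]]
    by (simp only: objective_component_diag_op[OF that] scale_cost_ge)
  have comp_lim: "(\<lambda>k. objective_component x l 0 (diag_op (u k)) i)
      \<longlonglongrightarrow> min_scale_cost (x $ i) (l $ i)" for i
    unfolding objective_component_diag_op[OF u] by (rule cost_lim)

  show "\<forall>S m. elementwise_metric S m \<longrightarrow>
      (is_arg_min (objective x l 0) (\<lambda>S. S \<in> elementwise_class) S \<longleftrightarrow>
        (\<forall>i. x $ i = 0 \<longrightarrow> l $ i = 0) \<and>
        (\<forall>i. x $ i \<noteq> 0 \<longrightarrow> m $ i = \<bar>x $ i / l $ i\<bar>)) \<and>
      (is_arg_min (objective x l 0) (\<lambda>S. S \<in> elementwise_class) S \<longleftrightarrow>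
        (\<forall>i. x $ i = 0 \<longrightarrow> l $ i = 0) \<and>
        (\<forall>i v. x $ i \<noteq> 0 \<longrightarrow> metric_of S v $ i = \<bar>l $ i / x $ i\<bar> * v $ i))"
  proof (intro allI impI)
    fix S :: "real ^ 'n \<Rightarrow> real ^ 'n" and m
    assume em: "elementwise_metric S m"
    then have "S \<in> elementwise_class"
      by (auto simp: elementwise_class_def)
    then have "is_arg_min (objective x l 0) (\<lambda>S. S \<in> elementwise_class) S \<longleftrightarrow>
        objective x l 0 S = ?C"
      by (intro is_arg_min_iff_approached_bound[where u = "\<lambda>k. diag_op (u k)"] lower mem lim)
    also have "\<dots> \<longleftrightarrow> (\<forall>i. \<bar>x $ i\<bar> = m $ i * \<bar>l $ i\<bar>)"
      by (rule objective_elementwise_eq_min_iff[OF em])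
    also have "\<dots> \<longleftrightarrow> (\<forall>i. x $ i = 0 \<longrightarrow> l $ i = 0) \<and>
        (\<forall>i. x $ i \<noteq> 0 \<longrightarrow> m $ i = \<bar>x $ i / l $ i\<bar>)"
      using abs_eq_scale_iff[OF nz elementwise_metric_pos[OF em]] by blast
    finally have argmin: "is_arg_min (objective x l 0) (\<lambda>S. S \<in> elementwise_class) S \<longleftrightarrow>
        (\<forall>i. x $ i = 0 \<longrightarrow> l $ i = 0) \<and>
        (\<forall>i. x $ i \<noteq> 0 \<longrightarrow> m $ i = \<bar>x $ i / l $ i\<bar>)" .
    have metric: "m $ i = \<bar>x $ i / l $ i\<bar> \<longleftrightarrow>
        (\<forall>v. metric_of S v $ i = \<bar>l $ i / x $ i\<bar> * v $ i)" if "x $ i \<noteq> 0" for i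
    proof -
      have "(\<forall>v. metric_of S v $ i = \<bar>l $ i / x $ i\<bar> * v $ i) \<longleftrightarrow>
          1 / m $ i = \<bar>l $ i / x $ i\<bar>"
      proof
        assume "\<forall>v. metric_of S v $ i = \<bar>l $ i / x $ i\<bar> * v $ i"
        \<comment> \<open>The all-ones vector reads off the diagonal factor of the metric.\<close>
        then have "metric_of S 1 $ i = \<bar>l $ i / x $ i\<bar> * 1 $ i"
          by blast
        then show "1 / m $ i = \<bar>l $ i / x $ i\<bar>"
          by (simp add: metric_of_elementwise[OF em])
      next
        assume "1 / m $ i = \<bar>l $ i / x $ i\<bar>"
        then show "\<forall>v. metric_of S v $ i = \<bar>l $ i / x $ i\<bar> * v $ i"
          by (metis metric_of_elementwise[OF em] mult_1 times_divide_eq_left)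
      qed
      also have "\<dots> \<longleftrightarrow> m $ i = \<bar>x $ i / l $ i\<bar>"
        using that nz[OF that] elementwise_metric_pos[OF em, of i] by (auto simp: field_simps)
      finally show ?thesis
        by simp
    qed
    show "(is_arg_min (objective x l 0) (\<lambda>S. S \<in> elementwise_class) S \<longleftrightarrow>
        (\<forall>i. x $ i = 0 \<longrightarrow> l $ i = 0) \<and>
        (\<forall>i. x $ i \<noteq> 0 \<longrightarrow> m $ i = \<bar>x $ i / l $ i\<bar>)) \<and>
      (is_arg_min (objective x l 0) (\<lambda>S. S \<in> elementwise_class) S \<longleftrightarrow>
        (\<forall>i. x $ i = 0 \<longrightarrow> l $ i = 0) \<and>
        (\<forall>i v. x $ i \<noteq> 0 \<longrightarrow> metric_of S v $ i = \<bar>l $ i / x $ i\<bar> * v $ i))"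
      using argmin metric by blast
  qed

  show "\<forall>S m. (\<forall>k. elementwise_metric (S k) (m k)) \<and>
      (\<forall>i. x $ i \<noteq> 0 \<longrightarrow> (\<lambda>k::nat. m k $ i) \<longlonglongrightarrow> \<bar>x $ i / l $ i\<bar>) \<and>
      (\<forall>i. x $ i = 0 \<and> l $ i \<noteq> 0 \<longrightarrow> (\<lambda>k. m k $ i) \<longlonglongrightarrow> 0) \<longrightarrow>
      (\<lambda>k. objective x l 0 (S k)) \<longlonglongrightarrow> (INF S\<in>elementwise_class. objective x l 0 S)"
  proof (intro allI impI, elim conjE)
    fix S :: "nat \<Rightarrow> real ^ 'n \<Rightarrow> real ^ 'n" and m
    assume em: "\<forall>k. elementwise_metric (S k) (m k)"
      and m: "\<forall>i. x $ i \<noteq> 0 \<longrightarrow> (\<lambda>k. m k $ i) \<longlonglongrightarrow> \<bar>x $ i / l $ i\<bar>"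
        "\<forall>i. x $ i = 0 \<and> l $ i \<noteq> 0 \<longrightarrow> (\<lambda>k. m k $ i) \<longlonglongrightarrow> 0"
    have "(\<lambda>k. objective x l 0 (S k)) \<longlonglongrightarrow> ?C"
      unfolding objective_elementwise[OF em[rule_format]]
      using nz m by (intro tendsto_sum tendsto_scale_cost) auto
    \<comment> \<open>That \<open>?C\<close> is the infimum is witnessed by the fixed sequence
      \<open>u\<close>, not by the given \<open>S\<close>.\<close>
    then show "(\<lambda>k. objective x l 0 (S k)) \<longlonglongrightarrow> (INF S\<in>elementwise_class. objective x l 0 S)"
      by (simp only: INF_eq_approached_bound[where u = "\<lambda>k. diag_op (u k)", OF lower mem lim])
  qed

  show "\<forall>i. x $ i \<noteq> 0 \<longrightarrow>
      (\<forall>h\<in>nonzero_vecs.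
        is_arg_min (\<lambda>h. objective_component x l 0 (diag_op h) i) (\<lambda>h. h \<in> nonzero_vecs) h \<longleftrightarrow>
        (h * h) $ i = \<bar>x $ i / l $ i\<bar>)"
  proof (intro allI impI ballI)
    fix i and h :: "real ^ 'n"
    assume x: "x $ i \<noteq> 0" and h: "h \<in> nonzero_vecs"
    have pos: "(h * h) $ i > 0"
      by (rule elementwise_metric_pos[OF elementwise_metric_diag_op[OF h]])
    have "is_arg_min (\<lambda>h. objective_component x l 0 (diag_op h) i) (\<lambda>h. h \<in> nonzero_vecs) h \<longleftrightarrow>
        objective_component x l 0 (diag_op h) i = min_scale_cost (x $ i) (l $ i)"
      by (rule is_arg_min_iff_approached_bound[where u = u, OF comp_lower u comp_lim h])
    also have "\<dots> \<longleftrightarrow> (h * h) $ i = \<bar>x $ i / l $ i\<bar>"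
      unfolding objective_component_diag_op[OF h] scale_cost_eq_min_iff[OF pos]
      using abs_eq_scale_iff[OF nz pos] x by blast
    finally show "is_arg_min (\<lambda>h. objective_component x l 0 (diag_op h) i)
        (\<lambda>h. h \<in> nonzero_vecs) h \<longleftrightarrow> (h * h) $ i = \<bar>x $ i / l $ i\<bar>" .
  qed

  show "\<forall>i. x $ i = 0 \<and> l $ i \<noteq> 0 \<longrightarrow>
      ((\<lambda>h. objective_component x l 0 (diag_op h) i) \<longlongrightarrow>
        (INF h\<in>nonzero_vecs. objective_component x l 0 (diag_op h) i)) (vanishing_entry i)"
  proof (intro allI impI)
    fix i assume i: "x $ i = 0 \<and> l $ i \<noteq> 0"
    have "((\<lambda>h. (h * h) $ i) \<longlongrightarrow> 0) (vanishing_entry i)"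
      using filterlim_vanishing_entry[of i] by (simp only: filterlim_at)
    then have "((\<lambda>h. scale_cost (x $ i) (l $ i) ((h * h) $ i)) \<longlongrightarrow> min_scale_cost (x $ i) (l $ i))
        (vanishing_entry i)"
      using i by (intro tendsto_scale_cost) auto
    \<comment> \<open>The formula for diagonal operators needs nonzero entries, which the principal
      part of the filter supplies.\<close>
    moreover have "\<forall>\<^sub>F h in vanishing_entry i. scale_cost (x $ i) (l $ i) ((h * h) $ i) =
        objective_component x l 0 (diag_op h) i"
      unfolding vanishing_entry_def eventually_inf_principal
      by (intro always_eventually) (simp add: objective_component_diag_op)
    ultimately have "((\<lambda>h. objective_component x l 0 (diag_op h) i) \<longlongrightarrow>
        min_scale_cost (x $ i) (l $ i)) (vanishing_entry i)"
      by (rule Lim_transform_eventually)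
    then show "((\<lambda>h. objective_component x l 0 (diag_op h) i) \<longlongrightarrow>
        (INF h\<in>nonzero_vecs. objective_component x l 0 (diag_op h) i)) (vanishing_entry i)"
      by (simp only: INF_eq_approached_bound[where u = u, OF comp_lower u comp_lim])
  qed

  show "\<forall>i. x $ i = 0 \<and> l $ i = 0 \<longrightarrow>
      (\<forall>h\<in>nonzero_vecs. \<forall>h'\<in>nonzero_vecs.
        objective_component x l 0 (diag_op h) i = objective_component x l 0 (diag_op h') i) \<and>
      (\<forall>S S' m m'. elementwise_metric S m \<and> elementwise_metric S' m' \<and>
        (\<forall>j. j \<noteq> i \<longrightarrow> m $ j = m' $ j) \<longrightarrow>
        objective x l 0 S = objective x l 0 S')"
  proof (intro allI impI conjI ballI; elim conjE)
    fix i assume i: "x $ i = 0" "l $ i = 0"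
    then have const: "scale_cost (x $ i) (l $ i) t = 0" for t
      by (simp add: scale_cost_def)
    show "objective_component x l 0 (diag_op h) i = objective_component x l 0 (diag_op h') i"
      if "h \<in> nonzero_vecs" "h' \<in> nonzero_vecs" for h h'
      using that by (simp only: objective_component_diag_op const)
    fix S S' :: "real ^ 'n \<Rightarrow> real ^ 'n" and m m'
    assume em: "elementwise_metric S m" "elementwise_metric S' m'"
      and eq: "\<forall>j. j \<noteq> i \<longrightarrow> m $ j = m' $ j"
    \<comment> \<open>At \<open>j = i\<close> both costs are zero whatever the entries; elsewhere
      the entries agree.\<close>
    have "scale_cost (x $ j) (l $ j) (m $ j) = scale_cost (x $ j) (l $ j) (m' $ j)" for j
      using eq const by (cases "j = i") auto
    then show "objective x l 0 S = objective x l 0 S'"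
      by (simp only: objective_elementwise[OF em(1)] objective_elementwise[OF em(2)])
  qed
qed

end
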